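(* Let $f\in\mathbb R[x,y,z]$ be a fixed non-degenerate quadratic polynomial, and let $\mu$ be an $\alpha$-AD-regular probability measure on $A=\operatorname{spt}(\mu)\subset[0,1]$, with $0<\alpha<1$. For $t\in\mathbb R$, set $$\mathcal F_t:=\{(x,y,z)\in A^3:f(x,y,z)=t\}.$$ Then, for every $t\in\mathbb R$, $$\overline{\dim}_{\mathrm B}\mathcal F_t\le2\alpha.$$
   Context: A quadratic polynomial $f\in\mathbb R[x,y,z]$ is called non-degenerate if it depends nontrivially on each of the three variables and is not of the form $G(I(x)+J(y)+K(z))$ for any polynomials $G,I,J,K\in\mathbb R[t]$. A probability measure $\mu$ is $\alpha$-AD-regular (Ahlfors--David regular) on its support if $\operatorname{diam}(\operatorname{spt}\mu)>0$ and there is $C_\mu>0$ such that $C_\mu^{-1}r^\alpha\le\mu(B(x,r))\le C_\mu r^\alpha$ for every $x\in\operatorname{spt}(\mu)$ and every $0<r\le\operatorname{diam}(\operatorname{spt}\mu)$. For a bounded set $E\subset\mathbb R^d$, $\mathscr C_r(E)$ is the smallest number of Euclidean balls of radius $r$ required to cover $E$, and $\overline{\dim}_{\mathrm B}E:=\limsup_{r\downarrow0}\frac{\log\mathscr C_r(E)}{-\log r}$, with the convention $\overline{\dim}_{\mathrm B}\emptyset=-\infty$. *)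

theory Defs
  imports "HOL-Probability.Probability" "HOL-Computational_Algebra.Polynomial"
begin

text \<open>
  Polynomials in \<open>\<real>[x,y,z]\<close> are represented by their polynomial functions; since \<open>\<real>\<close> is
  infinite, a real polynomial is determined by its function, so identities between
  polynomials may be read pointwise.
\<close>

definition quadratic_poly3 :: "(real \<Rightarrow> real \<Rightarrow> real \<Rightarrow> real) \<Rightarrow> bool" where
  "quadratic_poly3 f \<longleftrightarrow>
    (\<exists>a\<^sub>1 a\<^sub>2 a\<^sub>3 b\<^sub>1 b\<^sub>2 b\<^sub>3 c\<^sub>1 c\<^sub>2 c\<^sub>3 d.
      (a\<^sub>1 \<noteq> 0 \<or> a\<^sub>2 \<noteq> 0 \<or> a\<^sub>3 \<noteq> 0 \<or> b\<^sub>1 \<noteq> 0 \<or> b\<^sub>2 \<noteq> 0 \<or> b\<^sub>3 \<noteq> 0) \<and>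
      (\<forall>x y z. f x y z =
        a\<^sub>1 * x\<^sup>2 + a\<^sub>2 * y\<^sup>2 + a\<^sub>3 * z\<^sup>2 + b\<^sub>1 * (x * y) + b\<^sub>2 * (x * z) + b\<^sub>3 * (y * z)
          + c\<^sub>1 * x + c\<^sub>2 * y + c\<^sub>3 * z + d))"

definition nondegenerate3 :: "(real \<Rightarrow> real \<Rightarrow> real \<Rightarrow> real) \<Rightarrow> bool" where
  "nondegenerate3 f \<longleftrightarrow>
    (\<exists>x x' y z. f x y z \<noteq> f x' y z) \<and>
    (\<exists>x y y' z. f x y z \<noteq> f x y' z) \<and>
    (\<exists>x y z z'. f x y z \<noteq> f x y z') \<and>
    \<not> (\<exists>G I J K :: real poly. \<forall>x y z. f x y z = poly G (poly I x + poly J y + poly K z))"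

definition spt :: "'a::topological_space measure \<Rightarrow> 'a set" where
  "spt \<mu> = {x. \<forall>U. open U \<longrightarrow> x \<in> U \<longrightarrow> 0 < emeasure \<mu> U}"

text \<open>
  The library's \<open>diameter\<close> is the genuine diameter only for bounded sets, so the following
  notion is meant for measures with bounded support.  Balls are closed; using open balls
  would only change the constant \<open>C\<close>.
\<close>

definition AD_regular :: "real \<Rightarrow> 'a::metric_space measure \<Rightarrow> bool" where
  "AD_regular \<alpha> \<mu> \<longleftrightarrow>
    0 < diameter (spt \<mu>) \<and>
    (\<exists>C>0. \<forall>x\<in>spt \<mu>. \<forall>r. 0 < r \<longrightarrow> r \<le> diameter (spt \<mu>) \<longrightarrow>
      inverse C * r powr \<alpha> \<le> measure \<mu> (cball x r) \<and> measure \<mu> (cball x r) \<le> C * r powr \<alpha>)"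

text \<open>The centres of the covering balls are not required to lie in \<open>E\<close>.\<close>

definition covering_number :: "real \<Rightarrow> 'a::euclidean_space set \<Rightarrow> nat" where
  "covering_number r E = (LEAST n. \<exists>T. finite T \<and> card T = n \<and> E \<subseteq> (\<Union>c\<in>T. cball c r))"

text \<open>
  The empty set is treated separately because \<open>ln 0 = 0\<close> in HOL.
\<close>

definition upper_box_dim :: "'a::euclidean_space set \<Rightarrow> ereal" where
  "upper_box_dim E =
    (if E = {} then - \<infinity>
     else Limsup (at_right 0) (\<lambda>r. ereal (ln (real (covering_number r E)) / - ln r)))"

text \<open>
  \<open>\<real>\<^sup>3\<close> is \<open>real \<times> real \<times> real\<close>, whose product metric is the Euclidean one.
\<close>

definition level_set3 ::
    "(real \<Rightarrow> real \<Rightarrow> real \<Rightarrow> real) \<Rightarrow> real set \<Rightarrow> real \<Rightarrow> (real \<times> real \<times> real) set" where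
  "level_set3 f A t = {(x, y, z) \<in> A \<times> A \<times> A. f x y z = t}"

end

theory Submission
  imports Defs "HOL-Real_Asymp.Real_Asymp"
begin

text \<open>
  For a quadratic \<open>f\<close> one has \<open>f u - f v = (\<nabla>f u + \<nabla>f v) / 2 \<bullet> (u - v)\<close>.  Split the regular part
  of the level set into six pieces according to which signed partial derivative dominates
  \<open>\<nabla>f\<close>.  On a piece all gradients lie in one convex cone, so \<open>\<nabla>f u + \<nabla>f v\<close> does too, and the
  identity makes the piece a Lipschitz graph over the other two coordinates.  The singular part
  lies in a plane, because some second derivative is nonzero, and is again such a graph.
  Regularity covers \<open>A\<close> by \<open>O(r powr -\<alpha>)\<close> balls of radius \<open>r\<close>, hence each graph by
  \<open>O(r powr (-2 * \<alpha>))\<close> balls.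
\<close>

section \<open>Box dimension and regular measures\<close>

text \<open>Taking logarithms turns the constant into \<open>ln L / - ln r\<close>, which tends to 0
  with \<open>r\<close>, so only the exponent \<open>d\<close> survives in the limit
  superior.\<close>

lemma upper_box_dim_le:
  fixes E :: "'a::euclidean_space set"
  assumes "1 \<le> L" "0 \<le> d"
    and cover: "\<forall>\<^sub>F r in at_right 0. real (covering_number r E) \<le> L * r powr (- d)"
  shows "upper_box_dim E \<le> ereal d"
proof (cases "E = {}")
  case True
  then show ?thesis by (simp add: upper_box_dim_def)
next
  case False
  have "\<forall>\<^sub>F r in at_right 0. (0::real) < r \<and> r < 1"
    using eventually_at_right_real[of 0 "1::real"] by (auto elim: eventually_mono)
  with cover have "\<forall>\<^sub>F r in at_right 0.
      ereal (ln (real (covering_number r E)) / - ln r) \<le> ereal (ln (L * r powr (- d)) / - ln r)"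
  proof eventually_elim
    case (elim r)
    have "1 \<le> r powr (- d)"
      using elim assms(2) by (simp add: powr_minus one_le_inverse powr_le1)
    then have "1 \<le> L * r powr (- d)"
      using assms(1) mult_mono[of 1 L 1 "r powr (- d)"] by simp
    \<comment> \<open>Since \<open>ln 0 = 0\<close>, a covering number equal to 0 needs the
      right-hand logarithm to be nonnegative; this is why the majorant was first shown to be at
      least 1.\<close>
    then have "ln (real (covering_number r E)) \<le> ln (L * r powr (- d))"
      using elim by (cases "covering_number r E = 0") auto
    then show ?case
      using elim by (simp add: divide_right_mono_neg)
  qed
  then have "upper_box_dim E \<le>
      Limsup (at_right 0) (\<lambda>r. ereal (ln (L * r powr (- d)) / - ln r))"
    using False by (simp add: upper_box_dim_def Limsup_mono)
  also have "((\<lambda>r. ln (L * r powr (- d)) / - ln r) \<longlongrightarrow> d) (at_right 0)"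
    using assms(1,2) by real_asymp
  then have "Limsup (at_right 0) (\<lambda>r. ereal (ln (L * r powr (- d)) / - ln r)) = ereal d"
    by (intro lim_imp_Limsup tendsto_ereal) auto
  finally show ?thesis .
qed

lemma covering_number_le:
  assumes "finite T" "E \<subseteq> (\<Union>c\<in>T. cball c r)"
  shows "covering_number r E \<le> card T"
  unfolding covering_number_def using assms by (intro Least_le) blast

text \<open>The bound \<open>N\<close> guarantees a separated set of greatest cardinality. Such a
  set covers, because a point outside all the balls could be added to it.\<close>

lemma separated_card_bound_imp_cover:
  fixes A :: "'a::metric_space set"
  assumes bound: "\<And>S. \<lbrakk>finite S; S \<subseteq> A; pairwise (\<lambda>x y. r < dist x y) S\<rbrakk> \<Longrightarrow> card S \<le> N"
    and "0 \<le> r"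
  obtains S where "finite S" "S \<subseteq> A" "pairwise (\<lambda>x y. r < dist x y) S"
    "A \<subseteq> (\<Union>s\<in>S. cball s r)"
proof -
  define sep where "sep S \<longleftrightarrow> finite S \<and> S \<subseteq> A \<and> pairwise (\<lambda>x y. r < dist x y) S" for S
  have "sep {}" by (simp add: sep_def)
  moreover have "\<forall>S. sep S \<longrightarrow> card S < Suc N" using bound by (auto simp: sep_def less_Suc_eq_le)
  ultimately have "\<exists>S. sep S \<and> (\<forall>T. sep T \<longrightarrow> card T \<le> card S)"
    by (rule ex_has_greatest_nat)
  then obtain S where S: "sep S" and max: "\<And>T. sep T \<Longrightarrow> card T \<le> card S"
    by blast
  have "a \<in> (\<Union>s\<in>S. cball s r)" if "a \<in> A" for a
  proof (rule ccontr)
    assume far: "a \<notin> (\<Union>s\<in>S. cball s r)"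
    then have "a \<notin> S" using \<open>0 \<le> r\<close> by auto
    have "sep (insert a S)"
      using S that far by (auto simp: sep_def pairwise_insert dist_commute not_le)
    with max[of "insert a S"] \<open>a \<notin> S\<close> S show False by (auto simp: sep_def)
  qed
  then have "A \<subseteq> (\<Union>s\<in>S. cball s r)" by blast
  then show thesis using that S unfolding sep_def by blast
qed

text \<open>A packing argument: balls of radius \<open>r / 2\<close> about an
  \<open>r\<close>-separated subset of the support are disjoint, each has mass at least a constant
  times \<open>(r / 2) powr \<alpha>\<close>, and the total mass is 1. A maximal separated set then
  provides the cover.\<close>

lemma AD_regular_cover:
  fixes \<mu> :: "'a::metric_space measure"
  assumes "prob_space \<mu>" and sets: "sets \<mu> = sets borel" and "AD_regular \<alpha> \<mu>"
  obtains K where "0 < K"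
    "\<And>r. \<lbrakk>0 < r; r \<le> diameter (spt \<mu>)\<rbrakk> \<Longrightarrow>
       \<exists>S. finite S \<and> real (card S) \<le> K * r powr (- \<alpha>) \<and> spt \<mu> \<subseteq> (\<Union>s\<in>S. cball s r)"
proof -
  interpret prob_space \<mu> by fact
  obtain C where "0 < C" and C: "\<And>x r. \<lbrakk>x \<in> spt \<mu>; 0 < r; r \<le> diameter (spt \<mu>)\<rbrakk> \<Longrightarrow>
      inverse C * r powr \<alpha> \<le> prob (cball x r)"
    using assms(3) unfolding AD_regular_def by blast
  \<comment> \<open>The factor \<open>2 powr \<alpha>\<close> pays for halving the radius.\<close>
  define K where "K = C * 2 powr \<alpha>"
  have card: "real (card S) \<le> K * r powr (- \<alpha>)"
    if r: "0 < r" "r \<le> diameter (spt \<mu>)"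
      and S: "finite S" "S \<subseteq> spt \<mu>" "pairwise (\<lambda>x y. r < dist x y) S" for r S
  proof -
    have "disjoint_family_on (\<lambda>s. cball s (r / 2)) S"
      unfolding disjoint_family_on_def
    proof (intro ballI impI)
      fix a b assume "a \<in> S" "b \<in> S" "a \<noteq> b"
      then have "r < dist a b" using S(3) by (auto simp: pairwise_def)
      then have "\<not> (dist a z \<le> r / 2 \<and> dist b z \<le> r / 2)" for z
        using dist_triangle2[of a b z] by linarith
      then show "cball a (r / 2) \<inter> cball b (r / 2) = {}"
        by (simp add: disjoint_iff)
    qed
    then have "(\<Sum>s\<in>S. prob (cball s (r / 2))) = prob (\<Union>s\<in>S. cball s (r / 2))"
      using S(1) by (intro finite_measure_finite_Union[symmetric]) (simp_all add: sets image_subset_iff)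
    also have "\<dots> \<le> 1" by (rule prob_le_1)
    finally have "(\<Sum>s\<in>S. prob (cball s (r / 2))) \<le> 1" .
    moreover have "(\<Sum>s\<in>S. inverse C * (r / 2) powr \<alpha>) \<le> (\<Sum>s\<in>S. prob (cball s (r / 2)))"
      using S r by (intro sum_mono C) auto
    ultimately have "real (card S) * (inverse C * (r / 2) powr \<alpha>) \<le> 1" by simp
    also have "inverse C * (r / 2) powr \<alpha> = inverse (K * r powr (- \<alpha>))"
      using r by (simp add: K_def powr_minus powr_divide inverse_eq_divide)
    finally show ?thesis
      using pos_divide_le_eq[of "K * r powr (- \<alpha>)" "real (card S)" 1] \<open>0 < C\<close> r
      by (simp add: K_def divide_inverse)
  qed
  show thesis
  proof (rule that[of K])
    show "0 < K" using \<open>0 < C\<close> by (simp add: K_def)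
    fix r :: real assume r: "0 < r" "r \<le> diameter (spt \<mu>)"
    \<comment> \<open>Rounding down supplies the natural number bound that yields a maximal
      separated set; the real bound for that set comes again from \<open>card\<close>.\<close>
    have "card S \<le> nat \<lfloor>K * r powr (- \<alpha>)\<rfloor>"
      if "finite S" "S \<subseteq> spt \<mu>" "pairwise (\<lambda>x y. r < dist x y) S" for S
      using card[OF r that] by (simp add: le_nat_floor)
    then obtain S where "finite S" "S \<subseteq> spt \<mu>" "pairwise (\<lambda>x y. r < dist x y) S"
        "spt \<mu> \<subseteq> (\<Union>s\<in>S. cball s r)"
      by (rule separated_card_bound_imp_cover[OF _ less_imp_le[OF r(1)]])
    then show "\<exists>S. finite S \<and> real (card S) \<le> K * r powr (- \<alpha>) \<and> spt \<mu> \<subseteq> (\<Union>s\<in>S. cball s r)"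
      using card[OF r] by blast
  qed
qed

section \<open>Lipschitz graphs over two coordinates\<close>

text \<open>In other words, \<open>(p, q)\<close> is injective on \<open>P\<close> with an inverse
  that is 2-Lipschitz for the sum metric. The constant is fixed at 2 because a dominant normal
  component always yields it.\<close>

definition graph_over ::
    "('a \<Rightarrow> real) \<Rightarrow> ('a \<Rightarrow> real) \<Rightarrow> 'a::metric_space set \<Rightarrow> bool" where
  "graph_over p q P \<longleftrightarrow>
    (\<forall>u\<in>P. \<forall>v\<in>P. dist u v \<le> 2 * (dist (p u) (p v) + dist (q u) (q v)))"

text \<open>One point is chosen per cell of the grid \<open>S \<times> S\<close>. Two points of a
  cell differ by at most \<open>2 * r\<close> in each of \<open>p\<close> and \<open>q\<close>,
  hence by at most \<open>2 * (2 * r + 2 * r)\<close> in distance.\<close>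

lemma graph_over_cover:
  assumes "graph_over p q P" "finite S"
    and "p ` P \<subseteq> (\<Union>s\<in>S. cball s r)" "q ` P \<subseteq> (\<Union>s\<in>S. cball s r)"
  obtains T where "finite T" "card T \<le> (card S)\<^sup>2" "P \<subseteq> (\<Union>c\<in>T. cball c (8 * r))"
proof -
  define cell where
    "cell = (\<lambda>(s, s'). {u \<in> P. p u \<in> cball s r \<and> q u \<in> cball s' r})"
  define c where "c = (\<lambda>k. SOME u. u \<in> cell k)"
  show thesis
  proof
    show "finite (c ` (S \<times> S))" using assms(2) by simp
    show "card (c ` (S \<times> S)) \<le> (card S)\<^sup>2"
      using card_image_le[of "S \<times> S" c] assms(2) by (simp add: card_cartesian_product power2_eq_square)
    show "P \<subseteq> (\<Union>c\<in>c ` (S \<times> S). cball c (8 * r))"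
    proof
      fix u assume u: "u \<in> P"
      then obtain s s' where s: "s \<in> S" "s' \<in> S" "p u \<in> cball s r" "q u \<in> cball s' r"
        using assms(3,4) by blast
      then have "u \<in> cell (s, s')" using u by (simp add: cell_def)
      then have "c (s, s') \<in> cell (s, s')" unfolding c_def by (rule someI)
      then have v: "c (s, s') \<in> P" "p (c (s, s')) \<in> cball s r" "q (c (s, s')) \<in> cball s' r"
        by (auto simp: cell_def)
      have "dist (p (c (s, s'))) (p u) \<le> 2 * r" "dist (q (c (s, s'))) (q u) \<le> 2 * r"
        using s v by (auto simp: dist_real_def)
      moreover have "dist (c (s, s')) u
          \<le> 2 * (dist (p (c (s, s'))) (p u) + dist (q (c (s, s'))) (q u))"
        using assms(1) u v(1) by (auto simp: graph_over_def)
      ultimately have "u \<in> cball (c (s, s')) (8 * r)" by simp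
      then show "u \<in> (\<Union>c\<in>c ` (S \<times> S). cball c (8 * r))" using s by blast
    qed
  qed
qed

definition coordinate_graph :: "(real \<times> real \<times> real) set \<Rightarrow> bool" where
  "coordinate_graph P \<longleftrightarrow>
    graph_over (fst \<circ> snd) (snd \<circ> snd) P \<or> graph_over fst (snd \<circ> snd) P \<or> graph_over fst (fst \<circ> snd) P"

text \<open>Solve the linear relation for \<open>c * r\<close> and divide by the largest
  coefficient.\<close>

lemma dominant_coordinate_bound:
  fixes a b c p q r :: real
  assumes "a * p + b * q + c * r = 0" "\<bar>a\<bar> \<le> \<bar>c\<bar>" "\<bar>b\<bar> \<le> \<bar>c\<bar>" "c \<noteq> 0"
  shows "\<bar>r\<bar> \<le> \<bar>p\<bar> + \<bar>q\<bar>"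
proof -
  have "\<bar>c\<bar> * \<bar>r\<bar> = \<bar>a * p + b * q\<bar>"
    using assms(1) by (simp add: abs_mult[symmetric])
  also have "\<dots> \<le> \<bar>a\<bar> * \<bar>p\<bar> + \<bar>b\<bar> * \<bar>q\<bar>"
    by (metis abs_mult abs_triangle_ineq)
  also have "\<dots> \<le> \<bar>c\<bar> * (\<bar>p\<bar> + \<bar>q\<bar>)"
    using assms(2,3) by (simp add: distrib_left add_mono mult_right_mono)
  finally show ?thesis using assms(4) by simp
qed

lemma dist_triple_le:
  fixes x y z :: real
  shows "dist (x, y, z) (x', y', z') \<le> \<bar>x - x'\<bar> + \<bar>y - y'\<bar> + \<bar>z - z'\<bar>"
proof -
  have "dist (x, y, z) (x', y', z') \<le> \<bar>dist x x'\<bar> + \<bar>dist (y, z) (y', z')\<bar>"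
    unfolding dist_Pair_Pair[of x] by (rule sqrt_sum_squares_le_sum_abs)
  moreover have "dist (y, z) (y', z') \<le> \<bar>dist y y'\<bar> + \<bar>dist z z'\<bar>"
    unfolding dist_Pair_Pair by (rule sqrt_sum_squares_le_sum_abs)
  ultimately show ?thesis by (simp add: dist_real_def)
qed

text \<open>The displacement is orthogonal to the normal, so its entry at the dominant component is
  at most the sum of the other two in absolute value. Adding it at most doubles that sum, which
  gives the factor 2.\<close>

lemma dist_triple_le_of_normal:
  fixes x y z x' y' z' :: real
  assumes "g\<^sub>1 * (x - x') + g\<^sub>2 * (y - y') + g\<^sub>3 * (z - z') = 0"
  shows "\<lbrakk>\<bar>g\<^sub>2\<bar> \<le> \<bar>g\<^sub>1\<bar>; \<bar>g\<^sub>3\<bar> \<le> \<bar>g\<^sub>1\<bar>; g\<^sub>1 \<noteq> 0\<rbrakk> \<Longrightarrow>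
      dist (x, y, z) (x', y', z') \<le> 2 * (dist y y' + dist z z')"
    and "\<lbrakk>\<bar>g\<^sub>1\<bar> \<le> \<bar>g\<^sub>2\<bar>; \<bar>g\<^sub>3\<bar> \<le> \<bar>g\<^sub>2\<bar>; g\<^sub>2 \<noteq> 0\<rbrakk> \<Longrightarrow>
      dist (x, y, z) (x', y', z') \<le> 2 * (dist x x' + dist z z')"
    and "\<lbrakk>\<bar>g\<^sub>1\<bar> \<le> \<bar>g\<^sub>3\<bar>; \<bar>g\<^sub>2\<bar> \<le> \<bar>g\<^sub>3\<bar>; g\<^sub>3 \<noteq> 0\<rbrakk> \<Longrightarrow>
      dist (x, y, z) (x', y', z') \<le> 2 * (dist x x' + dist y y')"
  using assms dist_triple_le[of x y z x' y' z']
    dominant_coordinate_bound[of g\<^sub>2 "y - y'" g\<^sub>3 "z - z'" g\<^sub>1 "x - x'"]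
    dominant_coordinate_bound[of g\<^sub>1 "x - x'" g\<^sub>3 "z - z'" g\<^sub>2 "y - y'"]
    dominant_coordinate_bound[of g\<^sub>1 "x - x'" g\<^sub>2 "y - y'" g\<^sub>3 "z - z'"]
  unfolding dist_real_def by (simp_all add: add_ac)

text \<open>Differences of points of a plane are orthogonal to one fixed normal, whose largest
  component is nonzero. This serves the singular part of the level set.\<close>

lemma coordinate_graph_plane:
  assumes "g\<^sub>1 \<noteq> 0 \<or> g\<^sub>2 \<noteq> 0 \<or> g\<^sub>3 \<noteq> (0::real)"
    and "\<And>x y z. (x, y, z) \<in> P \<Longrightarrow> g\<^sub>1 * x + g\<^sub>2 * y + g\<^sub>3 * z = e"
  shows "coordinate_graph P"
proof -
  have eq: "g\<^sub>1 * (x - x') + g\<^sub>2 * (y - y') + g\<^sub>3 * (z - z') = 0"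
    if "(x, y, z) \<in> P" "(x', y', z') \<in> P" for x y z x' y' z'
    using assms(2)[OF that(1)] assms(2)[OF that(2)] by (simp add: algebra_simps)
  consider "\<bar>g\<^sub>2\<bar> \<le> \<bar>g\<^sub>1\<bar>" "\<bar>g\<^sub>3\<bar> \<le> \<bar>g\<^sub>1\<bar>" "g\<^sub>1 \<noteq> 0" | "\<bar>g\<^sub>1\<bar> \<le> \<bar>g\<^sub>2\<bar>" "\<bar>g\<^sub>3\<bar> \<le> \<bar>g\<^sub>2\<bar>" "g\<^sub>2 \<noteq> 0"
    | "\<bar>g\<^sub>1\<bar> \<le> \<bar>g\<^sub>3\<bar>" "\<bar>g\<^sub>2\<bar> \<le> \<bar>g\<^sub>3\<bar>" "g\<^sub>3 \<noteq> 0"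
    using assms(1) by linarith
  then show ?thesis
  proof cases
    case 1
    then have "graph_over (fst \<circ> snd) (snd \<circ> snd) P"
      using dist_triple_le_of_normal(1)[OF eq] by (auto simp: graph_over_def)
    then show ?thesis by (simp add: coordinate_graph_def)
  next
    case 2
    then have "graph_over fst (snd \<circ> snd) P"
      using dist_triple_le_of_normal(2)[OF eq] by (auto simp: graph_over_def)
    then show ?thesis by (simp add: coordinate_graph_def)
  next
    case 3
    then have "graph_over fst (fst \<circ> snd) P"
      using dist_triple_le_of_normal(3)[OF eq] by (auto simp: graph_over_def)
    then show ?thesis by (simp add: coordinate_graph_def)
  qed
qed

section \<open>Splitting a quadratic level set into coordinate graphs\<close>

lemma quadratic_level_set_graphs:
  assumes "quadratic_poly3 f"
  obtains \<P> where "finite \<P>" "{(x, y, z). f x y z = t} = \<Union>\<P>"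
    "\<And>P. P \<in> \<P> \<Longrightarrow> coordinate_graph P"
proof -
  obtain a\<^sub>1 a\<^sub>2 a\<^sub>3 b\<^sub>1 b\<^sub>2 b\<^sub>3 c\<^sub>1 c\<^sub>2 c\<^sub>3 d where
    nz: "a\<^sub>1 \<noteq> 0 \<or> a\<^sub>2 \<noteq> 0 \<or> a\<^sub>3 \<noteq> 0 \<or> b\<^sub>1 \<noteq> 0 \<or> b\<^sub>2 \<noteq> 0 \<or> b\<^sub>3 \<noteq> 0" and
    f: "\<And>x y z. f x y z =
        a\<^sub>1 * x\<^sup>2 + a\<^sub>2 * y\<^sup>2 + a\<^sub>3 * z\<^sup>2 + b\<^sub>1 * (x * y) + b\<^sub>2 * (x * z) + b\<^sub>3 * (y * z)
          + c\<^sub>1 * x + c\<^sub>2 * y + c\<^sub>3 * z + d"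
    using assms unfolding quadratic_poly3_def by blast
  \<comment> \<open>These are the partial derivatives of \<open>f\<close>, affine because
    \<open>f\<close> is quadratic.\<close>
  define f\<^sub>1 where "f\<^sub>1 x y z = 2 * a\<^sub>1 * x + b\<^sub>1 * y + b\<^sub>2 * z + c\<^sub>1" for x y z
  define f\<^sub>2 where "f\<^sub>2 x y z = b\<^sub>1 * x + 2 * a\<^sub>2 * y + b\<^sub>3 * z + c\<^sub>2" for x y z
  define f\<^sub>3 where "f\<^sub>3 x y z = b\<^sub>2 * x + b\<^sub>3 * y + 2 * a\<^sub>3 * z + c\<^sub>3" for x y z
  \<comment> \<open>The trapezoidal rule along a segment is exact for an affine gradient; the factor
    2 clears the mean.\<close>
  have "2 * (f x y z - f x' y' z') =
      (f\<^sub>1 x y z + f\<^sub>1 x' y' z') * (x - x') + (f\<^sub>2 x y z + f\<^sub>2 x' y' z') * (y - y')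
        + (f\<^sub>3 x y z + f\<^sub>3 x' y' z') * (z - z')" for x y z x' y' z'
    unfolding f f\<^sub>1_def f\<^sub>2_def f\<^sub>3_def by algebra
  then have eq: "(f\<^sub>1 x y z + f\<^sub>1 x' y' z') * (x - x') + (f\<^sub>2 x y z + f\<^sub>2 x' y' z') * (y - y')
        + (f\<^sub>3 x y z + f\<^sub>3 x' y' z') * (z - z') = 0"
    if "f x y z = t" "f x' y' z' = t" for x y z x' y' z'
    using that by (metis diff_self mult_zero_right)
  \<comment> \<open>For \<open>s\<close> equal to 1 or -1, the inequalities put the gradient in a
    convex cone with the sign of the dominant entry fixed. Adding two such gradients cannot cancel
    that entry and preserves its dominance.\<close>
  define X where "X s = {(x, y, z). f x y z = t \<and> 0 < s * f\<^sub>1 x y z \<and>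
      \<bar>f\<^sub>2 x y z\<bar> \<le> s * f\<^sub>1 x y z \<and> \<bar>f\<^sub>3 x y z\<bar> \<le> s * f\<^sub>1 x y z}" for s
  define Y where "Y s = {(x, y, z). f x y z = t \<and> 0 < s * f\<^sub>2 x y z \<and>
      \<bar>f\<^sub>1 x y z\<bar> \<le> s * f\<^sub>2 x y z \<and> \<bar>f\<^sub>3 x y z\<bar> \<le> s * f\<^sub>2 x y z}" for s
  define Z where "Z s = {(x, y, z). f x y z = t \<and> 0 < s * f\<^sub>3 x y z \<and>
      \<bar>f\<^sub>1 x y z\<bar> \<le> s * f\<^sub>3 x y z \<and> \<bar>f\<^sub>2 x y z\<bar> \<le> s * f\<^sub>3 x y z}" for s
  define W where "W = {(x, y, z). f x y z = t \<and> f\<^sub>1 x y z = 0 \<and> f\<^sub>2 x y z = 0 \<and> f\<^sub>3 x y z = 0}"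
  define \<P> where "\<P> = {X 1, X (-1), Y 1, Y (-1), Z 1, Z (-1), W}"
  have X: "coordinate_graph (X s)" if s: "s \<in> {1, -1}" for s
  proof -
    have "dist (x, y, z) (x', y', z') \<le> 2 * (dist y y' + dist z z')"
      if "(x, y, z) \<in> X s" "(x', y', z') \<in> X s" for x y z x' y' z'
      by (rule dist_triple_le_of_normal(1)[OF eq]) (use s that in \<open>auto simp: X_def\<close>)
    then have "graph_over (fst \<circ> snd) (snd \<circ> snd) (X s)"
      by (auto simp: graph_over_def)
    then show ?thesis by (simp add: coordinate_graph_def)
  qed
  have Y: "coordinate_graph (Y s)" if s: "s \<in> {1, -1}" for s
  proof -
    have "dist (x, y, z) (x', y', z') \<le> 2 * (dist x x' + dist z z')"
      if "(x, y, z) \<in> Y s" "(x', y', z') \<in> Y s" for x y z x' y' z'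
      by (rule dist_triple_le_of_normal(2)[OF eq]) (use s that in \<open>auto simp: Y_def\<close>)
    then have "graph_over fst (snd \<circ> snd) (Y s)"
      by (auto simp: graph_over_def)
    then show ?thesis by (simp add: coordinate_graph_def)
  qed
  have Z: "coordinate_graph (Z s)" if s: "s \<in> {1, -1}" for s
  proof -
    have "dist (x, y, z) (x', y', z') \<le> 2 * (dist x x' + dist y y')"
      if "(x, y, z) \<in> Z s" "(x', y', z') \<in> Z s" for x y z x' y' z'
      by (rule dist_triple_le_of_normal(3)[OF eq]) (use s that in \<open>auto simp: Z_def\<close>)
    then have "graph_over fst (fst \<circ> snd) (Z s)"
      by (auto simp: graph_over_def)
    then show ?thesis by (simp add: coordinate_graph_def)
  qed
  have W: "coordinate_graph W"
  proof -
    \<comment> \<open>The cases ask which row of the Hessian is nonzero; the vanishing of the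
      matching partial derivative on \<open>W\<close> is then the equation of a plane.\<close>
    consider "2 * a\<^sub>1 \<noteq> 0 \<or> b\<^sub>1 \<noteq> 0 \<or> b\<^sub>2 \<noteq> 0" | "b\<^sub>1 \<noteq> 0 \<or> 2 * a\<^sub>2 \<noteq> 0 \<or> b\<^sub>3 \<noteq> 0"
      | "b\<^sub>2 \<noteq> 0 \<or> b\<^sub>3 \<noteq> 0 \<or> 2 * a\<^sub>3 \<noteq> 0"
      using nz by auto
    then show ?thesis
    proof cases
      case 1
      then show ?thesis
        by (rule coordinate_graph_plane[where e = "- c\<^sub>1"]) (auto simp: W_def f\<^sub>1_def)
    next
      case 2
      then show ?thesis
        by (rule coordinate_graph_plane[where e = "- c\<^sub>2"]) (auto simp: W_def f\<^sub>2_def)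
    next
      case 3
      then show ?thesis
        by (rule coordinate_graph_plane[where e = "- c\<^sub>3"]) (auto simp: W_def f\<^sub>3_def)
    qed
  qed
  show thesis
  proof (rule that[of \<P>])
    show "finite \<P>" by (simp add: \<P>_def)
    show "coordinate_graph P" if "P \<in> \<P>" for P
      using that X Y Z W by (auto simp: \<P>_def)
    have "(x, y, z) \<in> \<Union>\<P>" if "f x y z = t" for x y z
    proof -
      \<comment> \<open>With \<open>s\<close> taken as the sign of the dominant partial derivative,
        the one-sided conditions become comparisons of absolute values.\<close>
      have abs: "sgn a * a = \<bar>a\<bar>" for a :: real by (simp add: sgn_if)
      let ?g\<^sub>1 = "f\<^sub>1 x y z" and ?g\<^sub>2 = "f\<^sub>2 x y z" and ?g\<^sub>3 = "f\<^sub>3 x y z"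
      consider "?g\<^sub>1 = 0" "?g\<^sub>2 = 0" "?g\<^sub>3 = 0"
        | "?g\<^sub>1 \<noteq> 0" "\<bar>?g\<^sub>2\<bar> \<le> \<bar>?g\<^sub>1\<bar>" "\<bar>?g\<^sub>3\<bar> \<le> \<bar>?g\<^sub>1\<bar>"
        | "?g\<^sub>2 \<noteq> 0" "\<bar>?g\<^sub>1\<bar> \<le> \<bar>?g\<^sub>2\<bar>" "\<bar>?g\<^sub>3\<bar> \<le> \<bar>?g\<^sub>2\<bar>"
        | "?g\<^sub>3 \<noteq> 0" "\<bar>?g\<^sub>1\<bar> \<le> \<bar>?g\<^sub>3\<bar>" "\<bar>?g\<^sub>2\<bar> \<le> \<bar>?g\<^sub>3\<bar>"
        by linarith
      then show ?thesis
      proof cases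
        case 1
        then have "(x, y, z) \<in> W" using that by (simp add: W_def)
        then show ?thesis by (simp add: \<P>_def)
      next
        case 2
        then have "(x, y, z) \<in> X (sgn ?g\<^sub>1)"
          using that by (simp add: X_def abs)
        then show ?thesis using 2 by (auto simp: \<P>_def sgn_if split: if_splits)
      next
        case 3
        then have "(x, y, z) \<in> Y (sgn ?g\<^sub>2)"
          using that by (simp add: Y_def abs)
        then show ?thesis using 3 by (auto simp: \<P>_def sgn_if split: if_splits)
      next
        case 4
        then have "(x, y, z) \<in> Z (sgn ?g\<^sub>3)"
          using that by (simp add: Z_def abs)
        then show ?thesis using 4 by (auto simp: \<P>_def sgn_if split: if_splits)
      qed
    qed
    then have "{(x, y, z). f x y z = t} \<subseteq> \<Union>\<P>" by blast
    moreover have "X s \<subseteq> {(x, y, z). f x y z = t}" "Y s \<subseteq> {(x, y, z). f x y z = t}"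
        "Z s \<subseteq> {(x, y, z). f x y z = t}" "W \<subseteq> {(x, y, z). f x y z = t}" for s
      unfolding X_def Y_def Z_def W_def by blast+
    then have "\<Union>\<P> \<subseteq> {(x, y, z). f x y z = t}"
      unfolding \<P>_def by (simp only: Union_insert Union_empty Un_subset_iff) simp
    ultimately show "{(x, y, z). f x y z = t} = \<Union>\<P>" by (rule subset_antisym)
  qed
qed

section \<open>Counting balls that cover the level set\<close>

lemma coordinate_graph_covering:
  assumes "coordinate_graph P" "finite S" "A \<subseteq> (\<Union>s\<in>S. cball s r)"
  obtains T where "finite T" "card T \<le> (card S)\<^sup>2"
    "P \<inter> A \<times> A \<times> A \<subseteq> (\<Union>c\<in>T. cball c (8 * r))"
proof -
  let ?Q = "P \<inter> A \<times> A \<times> A"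
  have Q: "fst ` ?Q \<subseteq> (\<Union>s\<in>S. cball s r)" "(fst \<circ> snd) ` ?Q \<subseteq> (\<Union>s\<in>S. cball s r)"
    "(snd \<circ> snd) ` ?Q \<subseteq> (\<Union>s\<in>S. cball s r)"
    using assms(3) by auto
  \<comment> \<open>The Lipschitz condition concerns pairs of points, so it passes to
    subsets.\<close>
  from assms(1) have "graph_over (fst \<circ> snd) (snd \<circ> snd) ?Q \<or> graph_over fst (snd \<circ> snd) ?Q
      \<or> graph_over fst (fst \<circ> snd) ?Q"
    unfolding coordinate_graph_def graph_over_def by blast
  then show thesis
  proof (elim disjE)
    assume "graph_over (fst \<circ> snd) (snd \<circ> snd) ?Q"
    then show thesis using assms(2) Q(2,3) by (rule graph_over_cover) (rule that)
  next
    assume "graph_over fst (snd \<circ> snd) ?Q"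
    then show thesis using assms(2) Q(1,3) by (rule graph_over_cover) (rule that)
  next
    assume "graph_over fst (fst \<circ> snd) ?Q"
    then show thesis using assms(2) Q(1,2) by (rule graph_over_cover) (rule that)
  qed
qed

text \<open>Each piece contributes at most \<open>(card S)\<^sup>2\<close> balls, and the union over
  the pieces costs only the factor \<open>card \<P>\<close>, which does not depend on
  \<open>r\<close>.\<close>

lemma covering_number_level_set3_le:
  assumes "finite \<P>" "{(x, y, z). f x y z = t} = \<Union>\<P>"
    and "\<And>P. P \<in> \<P> \<Longrightarrow> coordinate_graph P"
    and "finite S" "A \<subseteq> (\<Union>s\<in>S. cball s r)"
  shows "covering_number (8 * r) (level_set3 f A t) \<le> card \<P> * (card S)\<^sup>2"
proof -
  have "\<exists>T. finite T \<and> card T \<le> (card S)\<^sup>2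
      \<and> P \<inter> A \<times> A \<times> A \<subseteq> (\<Union>c\<in>T. cball c (8 * r))" if "P \<in> \<P>" for P
    by (rule coordinate_graph_covering[OF assms(3)[OF that] assms(4,5)]) blast
  then obtain T where T: "\<And>P. P \<in> \<P> \<Longrightarrow> finite (T P) \<and> card (T P) \<le> (card S)\<^sup>2
      \<and> P \<inter> A \<times> A \<times> A \<subseteq> (\<Union>c\<in>T P. cball c (8 * r))"
    by metis
  have "level_set3 f A t = \<Union>\<P> \<inter> A \<times> A \<times> A"
    unfolding assms(2)[symmetric] level_set3_def by auto
  also have "\<dots> \<subseteq> (\<Union>c\<in>(\<Union>P\<in>\<P>. T P). cball c (8 * r))"
    using T by fastforce
  finally have "covering_number (8 * r) (level_set3 f A t) \<le> card (\<Union>P\<in>\<P>. T P)"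
    using assms(1) T by (intro covering_number_le) auto
  also have "\<dots> \<le> (\<Sum>P\<in>\<P>. card (T P))"
    using assms(1) by (rule card_UN_le)
  also have "\<dots> \<le> card \<P> * (card S)\<^sup>2"
    using T sum_bounded_above[of \<P> "\<lambda>P. card (T P)"] by simp
  finally show ?thesis .
qed

theorem proposition4p3:
  fixes f :: "real \<Rightarrow> real \<Rightarrow> real \<Rightarrow> real" and \<mu> :: "real measure"
    and A :: "real set" and \<alpha> t :: real
  assumes "quadratic_poly3 f" and "nondegenerate3 f"
    and "prob_space \<mu>" and "sets \<mu> = sets borel"
    and "A = spt \<mu>" and "A \<subseteq> {0..1}"
    and "0 < \<alpha>" and "\<alpha> < 1" and "AD_regular \<alpha> \<mu>"
  shows "upper_box_dim (level_set3 f A t) \<le> ereal (2 * \<alpha>)"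
proof -
  obtain \<P> where \<P>: "finite \<P>" "{(x, y, z). f x y z = t} = \<Union>\<P>"
      "\<And>P. P \<in> \<P> \<Longrightarrow> coordinate_graph P"
    using quadratic_level_set_graphs[OF assms(1)] by blast
  obtain K where "0 < K" and K: "\<And>r. \<lbrakk>0 < r; r \<le> diameter A\<rbrakk> \<Longrightarrow>
       \<exists>S. finite S \<and> real (card S) \<le> K * r powr (- \<alpha>) \<and> A \<subseteq> (\<Union>s\<in>S. cball s r)"
    using AD_regular_cover[OF assms(3,4,9)] unfolding assms(5) by blast
  \<comment> \<open>\<open>A\<close> is covered at scale \<open>r / 8\<close>, so that the balls for
    the level set have radius \<open>r\<close>. This gives \<open>8 powr \<alpha>\<close>, and the
    square reflects the two free coordinates.\<close>
  define L where "L = real (card \<P>) * (K * 8 powr \<alpha>)\<^sup>2"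
  have "0 < diameter A" using assms(5,9) by (simp add: AD_regular_def)
  \<comment> \<open>This range keeps \<open>r / 8\<close> below the diameter, where regularity
    supplies covers.\<close>
  then have "\<forall>\<^sub>F r in at_right 0. r \<in> {0<..<8 * diameter A}"
    by (intro eventually_at_right_real) simp
  then have "\<forall>\<^sub>F r in at_right 0.
      real (covering_number r (level_set3 f A t)) \<le> max 1 L * r powr (- (2 * \<alpha>))"
  proof eventually_elim
    case (elim r)
    then obtain S where S: "finite S" "real (card S) \<le> K * (r / 8) powr (- \<alpha>)"
        "A \<subseteq> (\<Union>s\<in>S. cball s (r / 8))"
      using K[of "r / 8"] by auto
    have "real (covering_number r (level_set3 f A t)) \<le> real (card \<P> * (card S)\<^sup>2)"
      using covering_number_level_set3_le[OF \<P> S(1,3)] by (intro of_nat_mono) simp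
    also have "\<dots> \<le> real (card \<P>) * (K * (r / 8) powr (- \<alpha>))\<^sup>2"
      using S(2) by (simp add: mult_left_mono power_mono)
    also have "\<dots> = L * r powr (- (2 * \<alpha>))"
      using elim by (simp add: L_def power_mult_distrib powr_divide powr_minus powr_power
          field_simps)
    \<comment> \<open>The maximum provides the constant of at least 1 that
      \<open>upper_box_dim_le\<close> asks for.\<close>
    also have "\<dots> \<le> max 1 L * r powr (- (2 * \<alpha>))"
      by (simp add: mult_right_mono)
    finally show ?case .
  qed
  then show ?thesis
    using assms(7) by (intro upper_box_dim_le[of "max 1 L"]) auto
qed

end
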